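(* Let $\mathcal{V}=(V,\otimes,I,\alpha,l,r)$ be a monoidal category and $\mathbb{S}=(S,e_S,m_S)$ a monoid in $\mathcal{V}$ such that the morphism $e_S:I\to S$ is right pure, i.e. $e_S\otimes Z:I\otimes Z\to S\otimes Z$ is a monomorphism for every object $Z$ of $\mathcal{V}$. Then $\mathbf{I}^l_{\mathcal{V}}(\mathbb{S})$ has the structure of a monoid in which the product $[(J_1,i_{J_1})]\cdot[(J_2,i_{J_2})]$ of two elements is the equivalence class of the pair $(J_1\otimes J_2,i_{J_1\otimes J_2})$, where $i_{J_1\otimes J_2}$ is the composite $$J_1\otimes J_2\xrightarrow{\,i_{J_1}\otimes i_{J_2}\,}S\otimes S\xrightarrow{\,m_S\,}S.$$ Moreover, the element $[(I,e_S:I\to S)]$ is a two-sided unit for this multiplication.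
   Context: For a monoid $\mathbb{S}=(S,e_S,m_S)$ in a monoidal category $\mathcal{V}$ (unit $e_S:I\to S$, multiplication $m_S:S\otimes S\to S$), $\mathbf{I}^l_{\mathcal{V}}(\mathbb{S})$ denotes the class of those subobjects $[(J,i_J:J\to S)]$ of $S$ (equivalence classes of monomorphisms with codomain $S$, with $i_J\sim i_{J'}$ iff $i_J=i_{J'}k$ for an isomorphism $k:J\to J'$) for which the composite $\xi^l_{i_J}=m_S\cdot(S\otimes i_J):S\otimes J\to S\otimes S\to S$ is an isomorphism. "Monoid" as a structure on $\mathbf{I}^l_{\mathcal{V}}(\mathbb{S})$ means an associative product with two-sided unit. *)

theory Defs
  imports "HOL-Algebra.Group"
begin

text \<open>Categories are given by sets of objects and arrows inside two carrier types. Every arrow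
  has exactly one domain and codomain. The values of the operations outside the stated
  domains are irrelevant. Composition is written in the applicative order:
  \<open>g \<bullet> f\<close> means first \<open>f\<close>, then \<open>g\<close>.\<close>

record ('o, 'm) category =
  Obj :: "'o set"
  Arr :: "'m set"
  Dom :: "'m \<Rightarrow> 'o"
  Cod :: "'m \<Rightarrow> 'o"
  Id :: "'o \<Rightarrow> 'm"
  Comp :: "'m \<Rightarrow> 'm \<Rightarrow> 'm" (infixl "\<bullet>\<index>" 65)

definition Hom :: "('o, 'm, 'x) category_scheme \<Rightarrow> 'o \<Rightarrow> 'o \<Rightarrow> 'm set" where
  "Hom C X Y = {f \<in> Arr C. Dom C f = X \<and> Cod C f = Y}"

locale category =
  fixes C :: "('o, 'm, 'x) category_scheme" (structure)
  assumes Dom_in_Obj: "f \<in> Arr C \<Longrightarrow> Dom C f \<in> Obj C"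
    and Cod_in_Obj: "f \<in> Arr C \<Longrightarrow> Cod C f \<in> Obj C"
    and Id_in_Hom: "X \<in> Obj C \<Longrightarrow> Id C X \<in> Hom C X X"
    and Comp_in_Hom: "\<lbrakk>f \<in> Hom C X Y; g \<in> Hom C Y Z\<rbrakk> \<Longrightarrow> g \<bullet> f \<in> Hom C X Z"
    and Comp_Id_right: "f \<in> Hom C X Y \<Longrightarrow> f \<bullet> Id C X = f"
    and Comp_Id_left: "f \<in> Hom C X Y \<Longrightarrow> Id C Y \<bullet> f = f"
    and Comp_assoc: "\<lbrakk>f \<in> Hom C W X; g \<in> Hom C X Y; h \<in> Hom C Y Z\<rbrakk>
      \<Longrightarrow> (h \<bullet> g) \<bullet> f = h \<bullet> (g \<bullet> f)"

definition is_mono :: "('o, 'm, 'x) category_scheme \<Rightarrow> 'm \<Rightarrow> bool" where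
  "is_mono C f \<longleftrightarrow> f \<in> Arr C \<and>
    (\<forall>W \<in> Obj C. \<forall>g \<in> Hom C W (Dom C f). \<forall>h \<in> Hom C W (Dom C f).
      f \<bullet>\<^bsub>C\<^esub> g = f \<bullet>\<^bsub>C\<^esub> h \<longrightarrow> g = h)"

definition is_iso :: "('o, 'm, 'x) category_scheme \<Rightarrow> 'm \<Rightarrow> bool" where
  "is_iso C f \<longleftrightarrow> f \<in> Arr C \<and>
    (\<exists>g \<in> Hom C (Cod C f) (Dom C f).
      g \<bullet>\<^bsub>C\<^esub> f = Id C (Dom C f) \<and> f \<bullet>\<^bsub>C\<^esub> g = Id C (Cod C f))"

text \<open>The tensor product is \<open>\<odot>\<close> on objects and \<open>\<boxtimes>\<close> on arrows. The structural arrows are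
  oriented as \<open>\<alpha> : (X \<odot> Y) \<odot> Z \<rightarrow> X \<odot> (Y \<odot> Z)\<close>, \<open>l : I \<odot> X \<rightarrow> X\<close> and \<open>r : X \<odot> I \<rightarrow> X\<close>.\<close>

record ('o, 'm) monoidal_category = "('o, 'm) category" +
  TensorO :: "'o \<Rightarrow> 'o \<Rightarrow> 'o" (infixr "\<odot>\<index>" 75)
  TensorA :: "'m \<Rightarrow> 'm \<Rightarrow> 'm" (infixr "\<boxtimes>\<index>" 75)
  Unit :: "'o"
  Assoc :: "'o \<Rightarrow> 'o \<Rightarrow> 'o \<Rightarrow> 'm"
  LUnit :: "'o \<Rightarrow> 'm"
  RUnit :: "'o \<Rightarrow> 'm"

locale monoidal_category = category V
  for V :: "('o, 'm, 'x) monoidal_category_scheme" (structure) +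
  assumes TensorO_in_Obj: "\<lbrakk>X \<in> Obj V; Y \<in> Obj V\<rbrakk> \<Longrightarrow> X \<odot> Y \<in> Obj V"
    and TensorA_in_Hom: "\<lbrakk>f \<in> Hom V X X'; g \<in> Hom V Y Y'\<rbrakk>
      \<Longrightarrow> f \<boxtimes> g \<in> Hom V (X \<odot> Y) (X' \<odot> Y')"
    and TensorA_Id: "\<lbrakk>X \<in> Obj V; Y \<in> Obj V\<rbrakk> \<Longrightarrow> Id V X \<boxtimes> Id V Y = Id V (X \<odot> Y)"
    and TensorA_Comp: "\<lbrakk>f \<in> Hom V X X'; f' \<in> Hom V X' X''; g \<in> Hom V Y Y'; g' \<in> Hom V Y' Y''\<rbrakk>
      \<Longrightarrow> (f' \<bullet> f) \<boxtimes> (g' \<bullet> g) = (f' \<boxtimes> g') \<bullet> (f \<boxtimes> g)"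
    and Unit_in_Obj: "Unit V \<in> Obj V"
    and Assoc_in_Hom: "\<lbrakk>X \<in> Obj V; Y \<in> Obj V; Z \<in> Obj V\<rbrakk>
      \<Longrightarrow> Assoc V X Y Z \<in> Hom V ((X \<odot> Y) \<odot> Z) (X \<odot> (Y \<odot> Z))"
    and Assoc_iso: "\<lbrakk>X \<in> Obj V; Y \<in> Obj V; Z \<in> Obj V\<rbrakk> \<Longrightarrow> is_iso V (Assoc V X Y Z)"
    and Assoc_natural: "\<lbrakk>f \<in> Hom V X X'; g \<in> Hom V Y Y'; h \<in> Hom V Z Z'\<rbrakk>
      \<Longrightarrow> Assoc V X' Y' Z' \<bullet> ((f \<boxtimes> g) \<boxtimes> h) = (f \<boxtimes> (g \<boxtimes> h)) \<bullet> Assoc V X Y Z"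
    and LUnit_in_Hom: "X \<in> Obj V \<Longrightarrow> LUnit V X \<in> Hom V (Unit V \<odot> X) X"
    and LUnit_iso: "X \<in> Obj V \<Longrightarrow> is_iso V (LUnit V X)"
    and LUnit_natural: "f \<in> Hom V X Y
      \<Longrightarrow> LUnit V Y \<bullet> (Id V (Unit V) \<boxtimes> f) = f \<bullet> LUnit V X"
    and RUnit_in_Hom: "X \<in> Obj V \<Longrightarrow> RUnit V X \<in> Hom V (X \<odot> Unit V) X"
    and RUnit_iso: "X \<in> Obj V \<Longrightarrow> is_iso V (RUnit V X)"
    and RUnit_natural: "f \<in> Hom V X Y
      \<Longrightarrow> RUnit V Y \<bullet> (f \<boxtimes> Id V (Unit V)) = f \<bullet> RUnit V X"
    and pentagon: "\<lbrakk>W \<in> Obj V; X \<in> Obj V; Y \<in> Obj V; Z \<in> Obj V\<rbrakk>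
      \<Longrightarrow> Assoc V W X (Y \<odot> Z) \<bullet> Assoc V (W \<odot> X) Y Z =
        (Id V W \<boxtimes> Assoc V X Y Z) \<bullet> Assoc V W (X \<odot> Y) Z \<bullet> (Assoc V W X Y \<boxtimes> Id V Z)"
    and triangle: "\<lbrakk>X \<in> Obj V; Y \<in> Obj V\<rbrakk>
      \<Longrightarrow> (Id V X \<boxtimes> LUnit V Y) \<bullet> Assoc V X (Unit V) Y = RUnit V X \<boxtimes> Id V Y"

locale monoid_in = monoidal_category V
  for V :: "('o, 'm, 'x) monoidal_category_scheme" (structure)
    and S :: 'o and e :: 'm and m :: 'm +
  assumes S_in_Obj: "S \<in> Obj V"
    and e_in_Hom: "e \<in> Hom V (Unit V) S"
    and m_in_Hom: "m \<in> Hom V (S \<odot> S) S"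
    and m_assoc: "m \<bullet> (m \<boxtimes> Id V S) = m \<bullet> (Id V S \<boxtimes> m) \<bullet> Assoc V S S S"
    and m_unit_left: "m \<bullet> (e \<boxtimes> Id V S) = LUnit V S"
    and m_unit_right: "m \<bullet> (Id V S \<boxtimes> e) = RUnit V S"

definition right_pure :: "('o, 'm, 'x) monoidal_category_scheme \<Rightarrow> 'm \<Rightarrow> bool" where
  "right_pure V f \<longleftrightarrow> f \<in> Arr V \<and> (\<forall>Z \<in> Obj V. is_mono V (f \<boxtimes>\<^bsub>V\<^esub> Id V Z))"

definition monos_into :: "('o, 'm, 'x) category_scheme \<Rightarrow> 'o \<Rightarrow> ('o \<times> 'm) set" where
  "monos_into C S = {(J, i). J \<in> Obj C \<and> i \<in> Hom C J S \<and> is_mono C i}"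

definition subobject_rel :: "('o, 'm, 'x) category_scheme \<Rightarrow> 'o \<Rightarrow> ('o \<times> 'm) rel" where
  "subobject_rel C S = {((J, i), (J', i')). (J, i) \<in> monos_into C S \<and> (J', i') \<in> monos_into C S \<and>
    (\<exists>k \<in> Hom C J J'. is_iso C k \<and> i = i' \<bullet>\<^bsub>C\<^esub> k)}"

text \<open>The class \<open>[(J, i)]\<close>; it is empty, hence not a subobject, if \<open>i : J \<rightarrow> S\<close> is not a
  monomorphism.\<close>

definition subobject_class ::
  "('o, 'm, 'x) category_scheme \<Rightarrow> 'o \<Rightarrow> 'o \<times> 'm \<Rightarrow> ('o \<times> 'm) set" where
  "subobject_class C S p = subobject_rel C S `` {p}"

definition xi_left :: "('o, 'm, 'x) monoidal_category_scheme \<Rightarrow> 'o \<Rightarrow> 'm \<Rightarrow> 'm \<Rightarrow> 'm" where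
  "xi_left V S m i = m \<bullet>\<^bsub>V\<^esub> (Id V S \<boxtimes>\<^bsub>V\<^esub> i)"

definition I_left ::
  "('o, 'm, 'x) monoidal_category_scheme \<Rightarrow> 'o \<Rightarrow> 'm \<Rightarrow> ('o \<times> 'm) set set" where
  "I_left V S m = {subobject_class V S (J, i) | J i.
    (J, i) \<in> monos_into V S \<and> is_iso V (xi_left V S m i)}"

end

theory Submission
  imports Defs
begin

text \<open>Write \<open>\<xi>\<^sub>i = m (S \<otimes> i)\<close> for an arrow \<open>i : J \<rightarrow> S\<close>. Two identities carry the proof.

  The first is \<open>\<xi>\<^sub>i (e \<otimes> J) = i l\<^sub>J\<close>, a consequence of the left unit law of the monoid. If \<open>e\<close> is
  right pure and \<open>\<xi>\<^sub>i\<close> is invertible, the left side is a monomorphism; since \<open>l\<^sub>J\<close> is invertible, so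
  is \<open>i\<close>. Hence invertibility of \<open>\<xi>\<^sub>i\<close> already forces \<open>i\<close> to be a subobject
  (\<open>mono_if_iso_xi_left\<close>), and the tensor product of two subobjects, which need not be a subobject
  in general, causes no trouble here.

  The second is \<open>\<xi>\<^sub>i \<alpha> = \<xi>\<^bsub>i\<^sub>2\<^esub> (\<xi>\<^bsub>i\<^sub>1\<^esub> \<otimes> J\<^sub>2)\<close> for \<open>i = m (i\<^sub>1 \<otimes> i\<^sub>2)\<close>, a consequence of associativity.
  It shows that \<open>\<xi>\<^sub>i\<close> is invertible if \<open>\<xi>\<^bsub>i\<^sub>1\<^esub>\<close> and \<open>\<xi>\<^bsub>i\<^sub>2\<^esub>\<close> are (\<open>iso_xi_left_prod\<close>), so
  products exist. For the unit, \<open>\<xi>\<^sub>e = r\<^sub>S\<close> is invertible.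

  The monoid laws hold for classes because they hold for representatives up to the structural
  isomorphisms: the two bracketings of a triple product differ by \<open>\<alpha>\<close>, and multiplying \<open>i\<close> by \<open>e\<close> on
  the left or on the right gives \<open>i l\<^sub>J\<close> or \<open>i r\<^sub>J\<close>. The laws are therefore proved as instances of the
  relation \<open>subobject_rel\<close> and then transferred to the quotient.\<close>

section \<open>Isomorphisms and monomorphisms\<close>

lemma Hom_Obj:
  assumes "category C" "f \<in> Hom C X Y"
  shows "X \<in> Obj C" "Y \<in> Obj C"
  using assms category.Dom_in_Obj category.Cod_in_Obj unfolding Hom_def by fastforce+

lemma is_isoI:
  assumes "f \<in> Hom C X Y" "g \<in> Hom C Y X" "g \<bullet>\<^bsub>C\<^esub> f = Id C X" "f \<bullet>\<^bsub>C\<^esub> g = Id C Y"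
  shows "is_iso C f"
  using assms unfolding is_iso_def Hom_def by auto

lemma is_isoE:
  assumes "is_iso C f" "f \<in> Hom C X Y"
  obtains g where "g \<in> Hom C Y X" "g \<bullet>\<^bsub>C\<^esub> f = Id C X" "f \<bullet>\<^bsub>C\<^esub> g = Id C Y"
  using assms unfolding is_iso_def Hom_def by auto

lemma is_monoI:
  assumes "f \<in> Hom C X Y"
    and "\<And>W g h. \<lbrakk>g \<in> Hom C W X; h \<in> Hom C W X; f \<bullet>\<^bsub>C\<^esub> g = f \<bullet>\<^bsub>C\<^esub> h\<rbrakk> \<Longrightarrow> g = h"
  shows "is_mono C f"
  using assms unfolding is_mono_def Hom_def by blast

context category
begin

lemma is_monoD:
  assumes "is_mono C f" "f \<in> Hom C X Y" "g \<in> Hom C W X" "h \<in> Hom C W X" "f \<bullet> g = f \<bullet> h"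
  shows "g = h"
  using assms Hom_Obj(1)[OF category_axioms assms(3)] unfolding is_mono_def Hom_def by auto

lemma is_iso_Id: "X \<in> Obj C \<Longrightarrow> is_iso C (Id C X)"
  by (rule is_isoI[of _ _ X X "Id C X"]) (auto intro: Id_in_Hom Comp_Id_left)

lemma is_iso_Comp:
  assumes f: "f \<in> Hom C X Y" "is_iso C f" and g: "g \<in> Hom C Y Z" "is_iso C g"
  shows "is_iso C (g \<bullet> f)"
proof -
  obtain f' where f': "f' \<in> Hom C Y X" "f' \<bullet> f = Id C X" "f \<bullet> f' = Id C Y"
    by (rule is_isoE[OF f(2,1)])
  obtain g' where g': "g' \<in> Hom C Z Y" "g' \<bullet> g = Id C Y" "g \<bullet> g' = Id C Z"
    by (rule is_isoE[OF g(2,1)])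
  show ?thesis
  proof (rule is_isoI)
    show "g \<bullet> f \<in> Hom C X Z" "f' \<bullet> g' \<in> Hom C Z X"
      using f g f' g' Comp_in_Hom by auto
    have "f' \<bullet> g' \<bullet> (g \<bullet> f) = f' \<bullet> ((g' \<bullet> g) \<bullet> f)"
      using Comp_assoc[OF Comp_in_Hom[OF f(1) g(1)] g'(1) f'(1)] Comp_assoc[OF f(1) g(1) g'(1)]
      by simp
    then show "f' \<bullet> g' \<bullet> (g \<bullet> f) = Id C X"
      using f f' g' Comp_Id_left by simp
    have "g \<bullet> f \<bullet> (f' \<bullet> g') = g \<bullet> ((f \<bullet> f') \<bullet> g')"
      using Comp_assoc[OF Comp_in_Hom[OF g'(1) f'(1)] f(1) g(1)] Comp_assoc[OF g'(1) f'(1) f(1)]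
      by simp
    then show "g \<bullet> f \<bullet> (f' \<bullet> g') = Id C Z"
      using g f' g' Comp_Id_left by simp
  qed
qed

lemma is_iso_inverseE:
  assumes "f \<in> Hom C X Y" "is_iso C f"
  obtains g where "g \<in> Hom C Y X" "is_iso C g" "g \<bullet> f = Id C X" "f \<bullet> g = Id C Y"
proof (rule is_isoE[OF assms(2,1)])
  fix g assume g: "g \<in> Hom C Y X" "g \<bullet> f = Id C X" "f \<bullet> g = Id C Y"
  show thesis
    using that[OF g(1) is_isoI[OF g(1) assms(1) g(3,2)] g(2,3)] .
qed

lemma is_iso_cancel_right:
  assumes f: "f \<in> Hom C X Y" "is_iso C f" and g: "g \<in> Hom C Y Z" and gf: "is_iso C (g \<bullet> f)"
  shows "is_iso C g"
proof -
  obtain f' where f': "f' \<in> Hom C Y X" "is_iso C f'" "f' \<bullet> f = Id C X" "f \<bullet> f' = Id C Y"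
    by (rule is_iso_inverseE[OF f])
  have "(g \<bullet> f) \<bullet> f' = g"
    using Comp_assoc[OF f'(1) f(1) g] f'(4) Comp_Id_right[OF g] by simp
  then show ?thesis
    using is_iso_Comp[OF f'(1,2) Comp_in_Hom[OF f(1) g] gf] by simp
qed

lemma is_mono_iso_Comp:
  assumes f: "f \<in> Hom C X Y" "is_mono C f" and g: "g \<in> Hom C Y Z" "is_iso C g"
  shows "is_mono C (g \<bullet> f)"
proof (rule is_monoI[OF Comp_in_Hom[OF f(1) g(1)]])
  fix W p q
  assume p: "p \<in> Hom C W X" and q: "q \<in> Hom C W X" and eq: "g \<bullet> f \<bullet> p = g \<bullet> f \<bullet> q"
  obtain g' where g': "g' \<in> Hom C Z Y" "g' \<bullet> g = Id C Y" "g \<bullet> g' = Id C Z"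
    by (rule is_isoE[OF g(2,1)])
  have cancel: "g' \<bullet> (g \<bullet> f \<bullet> u) = f \<bullet> u" if u: "u \<in> Hom C W X" for u
    using Comp_assoc[OF u f(1) g(1)] Comp_assoc[OF Comp_in_Hom[OF u f(1)] g(1) g'(1)] g'(2)
      Comp_Id_left[OF Comp_in_Hom[OF u f(1)]] by simp
  have "f \<bullet> p = f \<bullet> q"
    using cancel[OF p] cancel[OF q] eq by simp
  then show "p = q"
    using is_monoD f p q by blast
qed

lemma is_mono_cancel_iso_right:
  assumes f: "f \<in> Hom C X Y" "is_iso C f" and g: "g \<in> Hom C Y Z" and gf: "is_mono C (g \<bullet> f)"
  shows "is_mono C g"
proof (rule is_monoI[OF g])
  fix W p q
  assume p: "p \<in> Hom C W Y" and q: "q \<in> Hom C W Y" and eq: "g \<bullet> p = g \<bullet> q"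
  obtain f' where f': "f' \<in> Hom C Y X" "f' \<bullet> f = Id C X" "f \<bullet> f' = Id C Y"
    by (rule is_isoE[OF f(2,1)])
  have shift: "f \<bullet> (f' \<bullet> u) = u" "g \<bullet> f \<bullet> (f' \<bullet> u) = g \<bullet> u" if u: "u \<in> Hom C W Y" for u
    using Comp_assoc[OF u f'(1) f(1)] Comp_assoc[OF Comp_in_Hom[OF u f'(1)] f(1) g] f'(3)
      Comp_Id_left[OF u] by simp_all
  have "f' \<bullet> p = f' \<bullet> q"
    using is_monoD[OF gf Comp_in_Hom[OF f(1) g], of "f' \<bullet> p" W "f' \<bullet> q"]
      shift(2)[OF p] shift(2)[OF q] eq p q f'(1) Comp_in_Hom by simp
  then show "p = q"
    using shift(1)[OF p] shift(1)[OF q] by metis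
qed

section \<open>Subobjects\<close>

lemma subobject_relI:
  assumes "k \<in> Hom C J J'" "is_iso C k" "i = i' \<bullet> k"
    and "(J, i) \<in> monos_into C S" "(J', i') \<in> monos_into C S"
  shows "((J, i), (J', i')) \<in> subobject_rel C S"
  using assms unfolding subobject_rel_def by auto

lemma equiv_subobject_rel: "equiv (monos_into C S) (subobject_rel C S)"
proof (rule equivI)
  show "subobject_rel C S \<subseteq> monos_into C S \<times> monos_into C S"
    unfolding subobject_rel_def by auto
  show "refl_on (monos_into C S) (subobject_rel C S)"
  proof (rule refl_onI)
    fix p assume p: "p \<in> monos_into C S"
    obtain J i where [simp]: "p = (J, i)" by fastforce
    have "J \<in> Obj C" "i \<in> Hom C J S"
      using p unfolding monos_into_def by auto
    then show "(p, p) \<in> subobject_rel C S"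
      using p Id_in_Hom is_iso_Id Comp_Id_right by (auto intro!: subobject_relI[of "Id C J"])
  qed
  show "sym (subobject_rel C S)"
  proof (rule symI)
    fix p q assume pq: "(p, q) \<in> subobject_rel C S"
    obtain J i J' i' where [simp]: "p = (J, i)" "q = (J', i')" by fastforce
    obtain k where k: "k \<in> Hom C J J'" "is_iso C k" "i = i' \<bullet> k"
      and i: "(J, i) \<in> monos_into C S" "(J', i') \<in> monos_into C S"
      using pq unfolding subobject_rel_def by auto
    obtain k' where k': "k' \<in> Hom C J' J" "is_iso C k'" "k' \<bullet> k = Id C J" "k \<bullet> k' = Id C J'"
      by (rule is_iso_inverseE[OF k(1,2)])
    have "i' \<in> Hom C J' S"
      using i unfolding monos_into_def by auto
    then have "i' = i \<bullet> k'"
      using k(3) Comp_assoc[OF k'(1) k(1)] k'(4) Comp_Id_right by simp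
    then show "(q, p) \<in> subobject_rel C S"
      using subobject_relI k' i by auto
  qed
  show "trans (subobject_rel C S)"
  proof (rule transI)
    fix p q s assume pq: "(p, q) \<in> subobject_rel C S" and qs: "(q, s) \<in> subobject_rel C S"
    obtain J i J' i' J'' i'' where [simp]: "p = (J, i)" "q = (J', i')" "s = (J'', i'')"
      by (metis surj_pair)
    obtain k where k: "k \<in> Hom C J J'" "is_iso C k" "i = i' \<bullet> k"
      and i: "(J, i) \<in> monos_into C S"
      using pq unfolding subobject_rel_def by auto
    obtain k' where k': "k' \<in> Hom C J' J''" "is_iso C k'" "i' = i'' \<bullet> k'"
      and i'': "(J'', i'') \<in> monos_into C S"
      using qs unfolding subobject_rel_def by auto
    have "i'' \<in> Hom C J'' S"
      using i'' unfolding monos_into_def by auto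
    then have "i = i'' \<bullet> (k' \<bullet> k)"
      using k(3) k'(3) Comp_assoc[OF k(1) k'(1)] by simp
    then show "(p, s) \<in> subobject_rel C S"
      using subobject_relI[OF Comp_in_Hom[OF k(1) k'(1)] is_iso_Comp[OF k(1,2) k'(1,2)]] i i''
      by auto
  qed
qed

lemma subobject_class_eq_iff:
  assumes "p \<in> monos_into C S" "q \<in> monos_into C S"
  shows "subobject_class C S p = subobject_class C S q \<longleftrightarrow> (p, q) \<in> subobject_rel C S"
  unfolding subobject_class_def using eq_equiv_class_iff[OF equiv_subobject_rel] assms by blast

end

section \<open>Invertibility of xi for products and for the unit\<close>

context monoidal_category
begin

lemma is_iso_TensorA:
  assumes f: "f \<in> Hom V X X'" "is_iso V f" and g: "g \<in> Hom V Y Y'" "is_iso V g"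
  shows "is_iso V (f \<boxtimes> g)"
proof -
  obtain f' where f': "f' \<in> Hom V X' X" "f' \<bullet> f = Id V X" "f \<bullet> f' = Id V X'"
    by (rule is_isoE[OF f(2,1)])
  obtain g' where g': "g' \<in> Hom V Y' Y" "g' \<bullet> g = Id V Y" "g \<bullet> g' = Id V Y'"
    by (rule is_isoE[OF g(2,1)])
  have "X \<in> Obj V" "X' \<in> Obj V" "Y \<in> Obj V" "Y' \<in> Obj V"
    using Hom_Obj[OF category_axioms f(1)] Hom_Obj[OF category_axioms g(1)] by auto
  then have "(f' \<boxtimes> g') \<bullet> (f \<boxtimes> g) = Id V (X \<odot> Y)" "(f \<boxtimes> g) \<bullet> (f' \<boxtimes> g') = Id V (X' \<odot> Y')"
    using TensorA_Comp[OF f(1) f'(1) g(1) g'(1)] TensorA_Comp[OF f'(1) f(1) g'(1) g(1)]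
      f' g' TensorA_Id by auto
  then show ?thesis
    using is_isoI[OF TensorA_in_Hom[OF f(1) g(1)] TensorA_in_Hom[OF f'(1) g'(1)]] by simp
qed

text \<open>The interchange law lets a tensor product of two arrows be applied one factor at a time.\<close>

lemma TensorA_split:
  assumes f: "f \<in> Hom V X X'" and g: "g \<in> Hom V Y Y'"
  shows "f \<boxtimes> g = (Id V X' \<boxtimes> g) \<bullet> (f \<boxtimes> Id V Y)"
    and "f \<boxtimes> g = (f \<boxtimes> Id V Y') \<bullet> (Id V X \<boxtimes> g)"
proof -
  note o = Hom_Obj[OF category_axioms f] Hom_Obj[OF category_axioms g]
  show "f \<boxtimes> g = (Id V X' \<boxtimes> g) \<bullet> (f \<boxtimes> Id V Y)"
    using TensorA_Comp[OF f Id_in_Hom[OF o(2)] Id_in_Hom[OF o(3)] g] f g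
    by (simp add: Comp_Id_left Comp_Id_right)
  show "f \<boxtimes> g = (f \<boxtimes> Id V Y') \<bullet> (Id V X \<boxtimes> g)"
    using TensorA_Comp[OF Id_in_Hom[OF o(1)] f g Id_in_Hom[OF o(4)]] f g
    by (simp add: Comp_Id_left Comp_Id_right)
qed

end

context monoid_in
begin

text \<open>The product of two arrows into \<open>S\<close>, regarded as generalized elements of the monoid.\<close>

definition gprod :: "'o \<times> 'm \<Rightarrow> 'o \<times> 'm \<Rightarrow> 'o \<times> 'm" where
  "gprod p q = (fst p \<odot> fst q, m \<bullet> (snd p \<boxtimes> snd q))"

lemma gprod_in_Hom:
  assumes "i \<in> Hom V J S" "i' \<in> Hom V J' S"
  shows "m \<bullet> (i \<boxtimes> i') \<in> Hom V (J \<odot> J') S"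
  using assms m_in_Hom TensorA_in_Hom Comp_in_Hom by blast

lemma xi_left_in_Hom:
  assumes "i \<in> Hom V J S"
  shows "xi_left V S m i \<in> Hom V (S \<odot> J) S"
  unfolding xi_left_def using gprod_in_Hom Id_in_Hom S_in_Obj assms by blast

lemma gprod_Comp:
  assumes i: "i \<in> Hom V J S" and k: "k \<in> Hom V K J"
    and i': "i' \<in> Hom V J' S" and k': "k' \<in> Hom V K' J'"
  shows "m \<bullet> ((i \<bullet> k) \<boxtimes> (i' \<bullet> k')) = m \<bullet> (i \<boxtimes> i') \<bullet> (k \<boxtimes> k')"
  using TensorA_Comp[OF k i k' i']
    Comp_assoc[OF TensorA_in_Hom[OF k k'] TensorA_in_Hom[OF i i'] m_in_Hom] by simp

lemma gprod_assoc:
  assumes i: "i \<in> Hom V J S" and i': "i' \<in> Hom V J' S" and i'': "i'' \<in> Hom V J'' S"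
  shows "m \<bullet> ((m \<bullet> (i \<boxtimes> i')) \<boxtimes> i'') = m \<bullet> (i \<boxtimes> (m \<bullet> (i' \<boxtimes> i''))) \<bullet> Assoc V J J' J''"
proof -
  note o = Hom_Obj(1)[OF category_axioms i] Hom_Obj(1)[OF category_axioms i']
    Hom_Obj(1)[OF category_axioms i'']
  note SS = S_in_Obj
  note idS = Id_in_Hom[OF S_in_Obj]
  note ii' = TensorA_in_Hom[OF i i'] and i'i'' = TensorA_in_Hom[OF i' i'']
  note a = Assoc_in_Hom[OF o] and aS = Assoc_in_Hom[OF SS SS SS]
  note mS = TensorA_in_Hom[OF m_in_Hom idS] and Sm = TensorA_in_Hom[OF idS m_in_Hom]
  note tl = TensorA_in_Hom[OF ii' i''] and tr = TensorA_in_Hom[OF i i'i'']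
  note mSm = Comp_in_Hom[OF Sm m_in_Hom]
  have "(m \<bullet> (i \<boxtimes> i')) \<boxtimes> i'' = (m \<boxtimes> Id V S) \<bullet> ((i \<boxtimes> i') \<boxtimes> i'')"
    using TensorA_Comp[OF ii' m_in_Hom i'' idS] Comp_Id_left[OF i''] by simp
  then have "m \<bullet> ((m \<bullet> (i \<boxtimes> i')) \<boxtimes> i'') = m \<bullet> (m \<boxtimes> Id V S) \<bullet> ((i \<boxtimes> i') \<boxtimes> i'')"
    using Comp_assoc[OF tl mS m_in_Hom] by simp
  also have "\<dots> = m \<bullet> (Id V S \<boxtimes> m) \<bullet> (Assoc V S S S \<bullet> ((i \<boxtimes> i') \<boxtimes> i''))"
    using m_assoc Comp_assoc[OF tl aS mSm] by simp
  also have "\<dots> = m \<bullet> (Id V S \<boxtimes> m) \<bullet> ((i \<boxtimes> (i' \<boxtimes> i'')) \<bullet> Assoc V J J' J'')"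
    using Assoc_natural[OF i i' i''] by simp
  also have "\<dots> = m \<bullet> ((Id V S \<boxtimes> m) \<bullet> (i \<boxtimes> (i' \<boxtimes> i''))) \<bullet> Assoc V J J' J''"
    using Comp_assoc[OF a tr mSm] Comp_assoc[OF tr Sm m_in_Hom] by simp
  also have "(Id V S \<boxtimes> m) \<bullet> (i \<boxtimes> (i' \<boxtimes> i'')) = i \<boxtimes> (m \<bullet> (i' \<boxtimes> i''))"
    using TensorA_Comp[OF i idS i'i'' m_in_Hom] Comp_Id_left[OF i] by simp
  finally show ?thesis .
qed

lemma gprod_unit_left:
  assumes i: "i \<in> Hom V J S"
  shows "m \<bullet> (e \<boxtimes> i) = i \<bullet> LUnit V J"
proof -
  note u = TensorA_in_Hom[OF Id_in_Hom[OF Unit_in_Obj] i]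
    and eS = TensorA_in_Hom[OF e_in_Hom Id_in_Hom[OF S_in_Obj]]
  have "m \<bullet> (e \<boxtimes> i) = m \<bullet> (e \<boxtimes> Id V S) \<bullet> (Id V (Unit V) \<boxtimes> i)"
    using TensorA_split(2)[OF e_in_Hom i] Comp_assoc[OF u eS m_in_Hom] by simp
  then show ?thesis
    using m_unit_left LUnit_natural[OF i] by simp
qed

lemma gprod_unit_right:
  assumes i: "i \<in> Hom V J S"
  shows "m \<bullet> (i \<boxtimes> e) = i \<bullet> RUnit V J"
proof -
  note u = TensorA_in_Hom[OF i Id_in_Hom[OF Unit_in_Obj]]
    and Se = TensorA_in_Hom[OF Id_in_Hom[OF S_in_Obj] e_in_Hom]
  have "m \<bullet> (i \<boxtimes> e) = m \<bullet> (Id V S \<boxtimes> e) \<bullet> (i \<boxtimes> Id V (Unit V))"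
    using TensorA_split(1)[OF i e_in_Hom] Comp_assoc[OF u Se m_in_Hom] by simp
  then show ?thesis
    using m_unit_right RUnit_natural[OF i] by simp
qed

text \<open>The arrow \<open>i\<close> differs by the invertible \<open>l\<^sub>J\<close> from \<open>\<xi>\<^sub>i (e \<otimes> J)\<close>, and purity makes \<open>e \<otimes> J\<close>
  a monomorphism.\<close>

lemma mono_if_iso_xi_left:
  assumes e: "right_pure V e" and i: "i \<in> Hom V J S" and xi: "is_iso V (xi_left V S m i)"
  shows "is_mono V i"
proof -
  have J: "J \<in> Obj V"
    using Hom_Obj(1)[OF category_axioms i] .
  note eJ = TensorA_in_Hom[OF e_in_Hom Id_in_Hom[OF J]]
    and Si = TensorA_in_Hom[OF Id_in_Hom[OF S_in_Obj] i]
  have "is_mono V (e \<boxtimes> Id V J)"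
    using e J unfolding right_pure_def by blast
  then have "is_mono V (xi_left V S m i \<bullet> (e \<boxtimes> Id V J))"
    using is_mono_iso_Comp eJ xi_left_in_Hom[OF i] xi by blast
  moreover have "xi_left V S m i \<bullet> (e \<boxtimes> Id V J) = i \<bullet> LUnit V J"
    unfolding xi_left_def
    using Comp_assoc[OF eJ Si m_in_Hom] TensorA_split(1)[OF e_in_Hom i] gprod_unit_left[OF i]
    by simp
  ultimately show ?thesis
    using is_mono_cancel_iso_right[OF LUnit_in_Hom[OF J] LUnit_iso[OF J] i] by simp
qed

lemma iso_xi_left_unit: "is_iso V (xi_left V S m e)"
  unfolding xi_left_def m_unit_right by (rule RUnit_iso[OF S_in_Obj])

lemma iso_xi_left_Comp:
  assumes i: "i \<in> Hom V J S" "is_iso V (xi_left V S m i)" and k: "k \<in> Hom V K J" "is_iso V k"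
  shows "is_iso V (xi_left V S m (i \<bullet> k))"
proof -
  note idS = Id_in_Hom[OF S_in_Obj]
  have "xi_left V S m (i \<bullet> k) = xi_left V S m i \<bullet> (Id V S \<boxtimes> k)"
    using gprod_Comp[OF idS idS i(1) k(1)] unfolding xi_left_def Comp_Id_left[OF idS] .
  then show ?thesis
    using is_iso_Comp[OF TensorA_in_Hom[OF idS k(1)] _ xi_left_in_Hom[OF i(1)] i(2)]
      is_iso_TensorA[OF idS is_iso_Id[OF S_in_Obj] k] by simp
qed

text \<open>Associativity, read with the identity of \<open>S\<close> as first factor, factors \<open>\<xi>\<close> of a product through
  the two given ones.\<close>

lemma iso_xi_left_prod:
  assumes i: "i \<in> Hom V J S" "is_iso V (xi_left V S m i)"
    and i': "i' \<in> Hom V J' S" "is_iso V (xi_left V S m i')"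
  shows "is_iso V (xi_left V S m (m \<bullet> (i \<boxtimes> i')))"
proof -
  have J: "J \<in> Obj V" and J': "J' \<in> Obj V"
    using Hom_Obj(1)[OF category_axioms] i i' by blast+
  note idS = Id_in_Hom[OF S_in_Obj] and idJ' = Id_in_Hom[OF J']
  note xi = xi_left_in_Hom[OF i(1)] and xi' = xi_left_in_Hom[OF i'(1)]
  note xiJ' = TensorA_in_Hom[OF xi idJ'] and Si' = TensorA_in_Hom[OF idS i'(1)]
  have "xi_left V S m (m \<bullet> (i \<boxtimes> i')) \<bullet> Assoc V S J J' = m \<bullet> (xi_left V S m i \<boxtimes> i')"
    unfolding xi_left_def using gprod_assoc[OF idS i(1) i'(1)] by simp
  also have "\<dots> = xi_left V S m i' \<bullet> (xi_left V S m i \<boxtimes> Id V J')"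
    using TensorA_split(1)[OF xi i'(1)] Comp_assoc[OF xiJ' Si' m_in_Hom]
    unfolding xi_left_def[of V S m i'] by simp
  finally have "is_iso V (xi_left V S m (m \<bullet> (i \<boxtimes> i')) \<bullet> Assoc V S J J')"
    using is_iso_Comp[OF xiJ' is_iso_TensorA[OF xi i(2) idJ' is_iso_Id[OF J']] xi' i'(2)] by simp
  then show ?thesis
    using is_iso_cancel_right[OF Assoc_in_Hom[OF S_in_Obj J J'] Assoc_iso[OF S_in_Obj J J']
        xi_left_in_Hom[OF gprod_in_Hom[OF i(1) i'(1)]]] by blast
qed

section \<open>The monoid of classes\<close>

definition I_rep :: "('o \<times> 'm) set" where
  "I_rep = {(J, i) \<in> monos_into V S. is_iso V (xi_left V S m i)}"

lemma I_rep_monos_into: "p \<in> I_rep \<Longrightarrow> p \<in> monos_into V S"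
  unfolding I_rep_def by blast

lemma I_repD:
  assumes "(J, i) \<in> I_rep"
  shows "J \<in> Obj V" "i \<in> Hom V J S" "is_iso V (xi_left V S m i)"
  using assms unfolding I_rep_def monos_into_def by auto

lemma I_repI:
  assumes "right_pure V e" "i \<in> Hom V J S" "is_iso V (xi_left V S m i)"
  shows "(J, i) \<in> I_rep"
  using assms Hom_Obj(1)[OF category_axioms assms(2)] mono_if_iso_xi_left
  unfolding I_rep_def monos_into_def by blast

lemma I_left_eq: "I_left V S m = subobject_class V S ` I_rep"
  unfolding I_left_def I_rep_def by (auto simp: image_iff)

lemma I_rep_closed_rel:
  assumes "(p, q) \<in> subobject_rel V S" "q \<in> I_rep"
  shows "p \<in> I_rep"
proof -
  obtain J i J' i' where [simp]: "p = (J, i)" "q = (J', i')" by fastforce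
  show ?thesis
    using assms iso_xi_left_Comp[of i' J'] I_repD[of J' i']
    unfolding subobject_rel_def I_rep_def by auto
qed

text \<open>Every representative of a class in \<open>I_left\<close> has invertible \<open>\<xi>\<close>, not only the one that witnesses
  the membership.\<close>

lemma I_rep_if_class_in_I_left:
  assumes "p \<in> monos_into V S" "subobject_class V S p \<in> I_left V S m"
  shows "p \<in> I_rep"
proof -
  obtain q where q: "q \<in> I_rep" "subobject_class V S p = subobject_class V S q"
    using assms(2) unfolding I_left_eq by blast
  then have "(p, q) \<in> subobject_rel V S"
    using subobject_class_eq_iff[OF assms(1) I_rep_monos_into[OF q(1)]] by simp
  then show ?thesis
    using I_rep_closed_rel q(1) by simp
qed

lemma gprod_in_I_rep:
  assumes "right_pure V e" "p \<in> I_rep" "q \<in> I_rep"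
  shows "gprod p q \<in> I_rep"
proof -
  obtain J i J' i' where pq: "p = (J, i)" "q = (J', i')" by fastforce
  note i = I_repD(2,3)[OF assms(2)[unfolded pq]] and i' = I_repD(2,3)[OF assms(3)[unfolded pq]]
  show ?thesis
    unfolding pq gprod_def fst_conv snd_conv
    by (rule I_repI[OF assms(1) gprod_in_Hom[OF i(1) i'(1)] iso_xi_left_prod[OF i i']])
qed

lemma unit_in_I_rep: "right_pure V e \<Longrightarrow> (Unit V, e) \<in> I_rep"
  by (rule I_repI[OF _ e_in_Hom iso_xi_left_unit])

lemma gprod_cong:
  assumes e: "right_pure V e" and p: "(p, p') \<in> subobject_rel V S" "p' \<in> I_rep"
    and q: "(q, q') \<in> subobject_rel V S" "q' \<in> I_rep"
  shows "(gprod p q, gprod p' q') \<in> subobject_rel V S"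
proof -
  obtain J i J' i' where [simp]: "p = (J, i)" "p' = (J', i')" by fastforce
  obtain K j K' j' where [simp]: "q = (K, j)" "q' = (K', j')" by fastforce
  obtain k where k: "k \<in> Hom V J J'" "is_iso V k" "i = i' \<bullet> k"
    using p unfolding subobject_rel_def by auto
  obtain h where h: "h \<in> Hom V K K'" "is_iso V h" "j = j' \<bullet> h"
    using q unfolding subobject_rel_def by auto
  have "i' \<in> Hom V J' S" "j' \<in> Hom V K' S"
    using p q I_repD by auto
  then have eq: "m \<bullet> (i \<boxtimes> j) = m \<bullet> (i' \<boxtimes> j') \<bullet> (k \<boxtimes> h)"
    using gprod_Comp k h by simp
  have "gprod p q \<in> monos_into V S" "gprod p' q' \<in> monos_into V S"
    using e p q I_rep_closed_rel gprod_in_I_rep I_rep_monos_into by blast+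
  then show ?thesis
    using subobject_relI[OF TensorA_in_Hom[OF k(1) h(1)] is_iso_TensorA[OF k(1,2) h(1,2)] eq]
    by (simp add: gprod_def)
qed

lemma gprod_assoc_rel:
  assumes e: "right_pure V e" and pqs: "p \<in> I_rep" "q \<in> I_rep" "s \<in> I_rep"
  shows "(gprod (gprod p q) s, gprod p (gprod q s)) \<in> subobject_rel V S"
proof -
  obtain J i J' i' J'' i'' where [simp]: "p = (J, i)" "q = (J', i')" "s = (J'', i'')"
    by (metis surj_pair)
  have o: "J \<in> Obj V" "J' \<in> Obj V" "J'' \<in> Obj V"
    and i: "i \<in> Hom V J S" "i' \<in> Hom V J' S" "i'' \<in> Hom V J'' S"
    using pqs I_repD by auto
  have "gprod (gprod p q) s \<in> monos_into V S" "gprod p (gprod q s) \<in> monos_into V S"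
    using e pqs gprod_in_I_rep I_rep_monos_into by blast+
  then show ?thesis
    using subobject_relI[OF Assoc_in_Hom[OF o] Assoc_iso[OF o] gprod_assoc[OF i]]
    by (simp add: gprod_def)
qed

lemma gprod_unit_left_rel:
  assumes e: "right_pure V e" and p: "p \<in> I_rep"
  shows "(gprod (Unit V, e) p, p) \<in> subobject_rel V S"
proof -
  obtain J i where [simp]: "p = (J, i)" by fastforce
  have J: "J \<in> Obj V" and i: "i \<in> Hom V J S"
    using p I_repD by auto
  have "gprod (Unit V, e) p \<in> monos_into V S" "p \<in> monos_into V S"
    using e p unit_in_I_rep gprod_in_I_rep I_rep_monos_into by blast+
  then show ?thesis
    using subobject_relI[OF LUnit_in_Hom[OF J] LUnit_iso[OF J] gprod_unit_left[OF i]]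
    by (simp add: gprod_def)
qed

lemma gprod_unit_right_rel:
  assumes e: "right_pure V e" and p: "p \<in> I_rep"
  shows "(gprod p (Unit V, e), p) \<in> subobject_rel V S"
proof -
  obtain J i where [simp]: "p = (J, i)" by fastforce
  have J: "J \<in> Obj V" and i: "i \<in> Hom V J S"
    using p I_repD by auto
  have "gprod p (Unit V, e) \<in> monos_into V S" "p \<in> monos_into V S"
    using e p unit_in_I_rep gprod_in_I_rep I_rep_monos_into by blast+
  then show ?thesis
    using subobject_relI[OF RUnit_in_Hom[OF J] RUnit_iso[OF J] gprod_unit_right[OF i]]
    by (simp add: gprod_def)
qed

text \<open>The product of two classes is the union of the classes of all products of representatives, so
  that no representative has to be chosen; by \<open>gprod_cong\<close> all classes in the union coincide.\<close>

definition I_monoid :: "('o \<times> 'm) set monoid" where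
  "I_monoid = \<lparr>carrier = I_left V S m,
    mult = (\<lambda>A B. \<Union>p\<in>A. \<Union>q\<in>B. subobject_class V S (gprod p q)),
    one = subobject_class V S (Unit V, e)\<rparr>"

lemma I_monoid_mult:
  assumes e: "right_pure V e" and p: "p \<in> I_rep" and q: "q \<in> I_rep"
  shows "subobject_class V S p \<otimes>\<^bsub>I_monoid\<^esub> subobject_class V S q = subobject_class V S (gprod p q)"
proof -
  have rep: "subobject_class V S (gprod p' q') = subobject_class V S (gprod p q)"
    if p': "p' \<in> subobject_class V S p" and q': "q' \<in> subobject_class V S q" for p' q'
  proof -
    have "(p', p) \<in> subobject_rel V S" "(q', q) \<in> subobject_rel V S"
      using p' q' equivE[OF equiv_subobject_rel] symD unfolding subobject_class_def Image_singleton_iff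
      by metis+
    then have "(gprod p' q', gprod p q) \<in> subobject_rel V S"
      using gprod_cong[OF e _ p _ q] by simp
    then show ?thesis
      unfolding subobject_class_def by (rule equiv_class_eq[OF equiv_subobject_rel])
  qed
  have "p \<in> subobject_class V S p" "q \<in> subobject_class V S q"
    unfolding subobject_class_def
    using equiv_class_self[OF equiv_subobject_rel] I_rep_monos_into[OF p] I_rep_monos_into[OF q]
    by simp_all
  then have "(\<Union>p'\<in>subobject_class V S p. \<Union>q'\<in>subobject_class V S q.
      subobject_class V S (gprod p' q')) = subobject_class V S (gprod p q)"
    using rep by blast
  then show ?thesis
    unfolding I_monoid_def monoid.select_convs .
qed

lemma monoid_I_monoid:
  assumes e: "right_pure V e"
  shows "monoid I_monoid"
proof -
  have carrier: "carrier I_monoid = subobject_class V S ` I_rep"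
    unfolding I_monoid_def I_left_eq by simp
  have one: "\<one>\<^bsub>I_monoid\<^esub> = subobject_class V S (Unit V, e)"
    unfolding I_monoid_def by simp
  have class_eq: "subobject_class V S p = subobject_class V S q"
    if "(p, q) \<in> subobject_rel V S" for p q
    unfolding subobject_class_def using equiv_class_eq[OF equiv_subobject_rel that] .
  note closed = gprod_in_I_rep[OF e] and unit = unit_in_I_rep[OF e] and mult = I_monoid_mult[OF e]
  show ?thesis
  proof (rule monoidI)
    show "\<one>\<^bsub>I_monoid\<^esub> \<in> carrier I_monoid"
      unfolding carrier one using unit by (rule imageI)
  next
    fix A B assume "A \<in> carrier I_monoid" "B \<in> carrier I_monoid"
    then obtain p q where p: "p \<in> I_rep" "A = subobject_class V S p"
      and q: "q \<in> I_rep" "B = subobject_class V S q"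
      unfolding carrier by blast
    show "A \<otimes>\<^bsub>I_monoid\<^esub> B \<in> carrier I_monoid"
      unfolding carrier p(2) q(2) mult[OF p(1) q(1)] using closed[OF p(1) q(1)] by (rule imageI)
  next
    fix A B D assume "A \<in> carrier I_monoid" "B \<in> carrier I_monoid" "D \<in> carrier I_monoid"
    then obtain p q s where p: "p \<in> I_rep" "A = subobject_class V S p"
      and q: "q \<in> I_rep" "B = subobject_class V S q" and s: "s \<in> I_rep" "D = subobject_class V S s"
      unfolding carrier by blast
    show "A \<otimes>\<^bsub>I_monoid\<^esub> B \<otimes>\<^bsub>I_monoid\<^esub> D = A \<otimes>\<^bsub>I_monoid\<^esub> (B \<otimes>\<^bsub>I_monoid\<^esub> D)"
      unfolding p(2) q(2) s(2) mult[OF p(1) q(1)] mult[OF q(1) s(1)]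
        mult[OF closed[OF p(1) q(1)] s(1)] mult[OF p(1) closed[OF q(1) s(1)]]
      by (rule class_eq[OF gprod_assoc_rel[OF e p(1) q(1) s(1)]])
  next
    fix A assume "A \<in> carrier I_monoid"
    then obtain p where p: "p \<in> I_rep" "A = subobject_class V S p"
      unfolding carrier by blast
    show "\<one>\<^bsub>I_monoid\<^esub> \<otimes>\<^bsub>I_monoid\<^esub> A = A"
      unfolding one p(2) mult[OF unit p(1)] by (rule class_eq[OF gprod_unit_left_rel[OF e p(1)]])
    show "A \<otimes>\<^bsub>I_monoid\<^esub> \<one>\<^bsub>I_monoid\<^esub> = A"
      unfolding one p(2) mult[OF p(1) unit] by (rule class_eq[OF gprod_unit_right_rel[OF e p(1)]])
  qed
qed

end

theorem proposition2p5:
  fixes V :: "('o, 'm, 'x) monoidal_category_scheme"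
    and S :: 'o and e m :: 'm
  assumes "monoidal_category V"
    and "monoid_in V S e m"
    and "right_pure V e"
  shows "\<exists>M :: ('o \<times> 'm) set monoid.
    monoid M \<and>
    carrier M = I_left V S m \<and>
    (\<forall>J\<^sub>1 i\<^sub>1 J\<^sub>2 i\<^sub>2.
      (J\<^sub>1, i\<^sub>1) \<in> monos_into V S \<longrightarrow> subobject_class V S (J\<^sub>1, i\<^sub>1) \<in> I_left V S m \<longrightarrow>
      (J\<^sub>2, i\<^sub>2) \<in> monos_into V S \<longrightarrow> subobject_class V S (J\<^sub>2, i\<^sub>2) \<in> I_left V S m \<longrightarrow>
      subobject_class V S (J\<^sub>1, i\<^sub>1) \<otimes>\<^bsub>M\<^esub> subobject_class V S (J\<^sub>2, i\<^sub>2) =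
        subobject_class V S (J\<^sub>1 \<odot>\<^bsub>V\<^esub> J\<^sub>2, m \<bullet>\<^bsub>V\<^esub> (i\<^sub>1 \<boxtimes>\<^bsub>V\<^esub> i\<^sub>2))) \<and>
    \<one>\<^bsub>M\<^esub> = subobject_class V S (Unit V, e)"
proof -
  interpret monoid_in V S e m by fact
  show ?thesis
  proof (intro exI[of _ I_monoid] conjI allI impI)
    show "monoid I_monoid"
      by (rule monoid_I_monoid[OF assms(3)])
    show "carrier I_monoid = I_left V S m"
      unfolding I_monoid_def by (rule partial_object.select_convs(1))
    show "\<one>\<^bsub>I_monoid\<^esub> = subobject_class V S (Unit V, e)"
      unfolding I_monoid_def by (rule monoid.select_convs(2))
  next
    fix J\<^sub>1 i\<^sub>1 J\<^sub>2 i\<^sub>2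
    assume 1: "(J\<^sub>1, i\<^sub>1) \<in> monos_into V S" "subobject_class V S (J\<^sub>1, i\<^sub>1) \<in> I_left V S m"
      and 2: "(J\<^sub>2, i\<^sub>2) \<in> monos_into V S" "subobject_class V S (J\<^sub>2, i\<^sub>2) \<in> I_left V S m"
    show "subobject_class V S (J\<^sub>1, i\<^sub>1) \<otimes>\<^bsub>I_monoid\<^esub> subobject_class V S (J\<^sub>2, i\<^sub>2) =
        subobject_class V S (J\<^sub>1 \<odot>\<^bsub>V\<^esub> J\<^sub>2, m \<bullet>\<^bsub>V\<^esub> (i\<^sub>1 \<boxtimes>\<^bsub>V\<^esub> i\<^sub>2))"
      using I_monoid_mult[OF assms(3) I_rep_if_class_in_I_left[OF 1] I_rep_if_class_in_I_left[OF 2]]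
      unfolding gprod_def fst_conv snd_conv .
  qed
qed

end
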